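(* Let $\mathbb{F}$ be a field of characteristic different from $2$ and let $L$ be an $n$-dimensional nilpotent Lie algebra over $\mathbb{F}$ of coclass $3$. If any one of the following conditions holds, then $\mathcal{A}(L)$ is a subgroup of $Aut(L)$: (1) $\dim L\leq 4$; (2) $\dim L=5$ and $\dim Z(L)\neq 1$; (3) $\dim L\geq 6$, and one of the following is satisfied: (i) the nilpotency class of $Z_2(L)$ is not equal to $2$; (ii) the nilpotency class of $Z_2(L)$ is $2$, and at least one of the following is true: $\dim Z(L)\neq 1$; $\dim Z_2(L)\neq 4$; $\dim L'\neq n-4$.
   Context: The lower central series is written $L\supseteq L^1=L'=[L,L]\supseteq L^2\supseteq\cdots$ with $L^{i+1}=[L,L^i]$ (and $L^0=L$). A Lie algebra is nilpotent if $L^m=0$ for some $m$; its nilpotency class is the $c$ with $L^{c-1}\neq 0$ and $L^c=0$. If $L$ is nilpotent of dimension $n$ and nilpotency class $c$, its coclass is $n-c$. $L'=[L,L]$ is the derived subalgebra, $Z(L)=\{x\in L : [x,y]=0\ \forall y\in L\}$ is the center, and $Z_2(L)=\{x\in L : [x,L]\subseteq Z(L)\}$ is the second center (an ideal, regarded as a Lie algebra in its own right when speaking of its nilpotency class). $Aut(L)$ is the group of Lie algebra automorphisms of $L$ under composition. The set of commuting automorphisms is $\mathcal{A}(L)=\{\alpha\in Aut(L) : [\alpha(x),x]=0\ \forall x\in L\}$. *)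

theory Defs
  imports Complex_Main "HOL-Algebra.Group"
begin

text \<open>
  A Lie algebra over a field, carried by a whole type. Its Lie subalgebras are sets of elements,
  and the algebra itself is the set \<^term>\<open>UNIV\<close>. The dimension of a subspace is
  \<^const>\<open>vector_space.dim\<close>, which is a natural number and hence only meaningful for
  finite-dimensional spaces.
\<close>

locale lie_algebra = vector_space scale
  for scale :: "'k::field \<Rightarrow> 'v::ab_group_add \<Rightarrow> 'v" (infixr "*s" 75) +
  fixes bracket :: "'v \<Rightarrow> 'v \<Rightarrow> 'v"
  assumes bracket_add_left: "bracket (x + y) z = bracket x z + bracket y z"
    and bracket_add_right: "bracket x (y + z) = bracket x y + bracket x z"
    and bracket_scale_left: "bracket (a *s x) y = a *s bracket x y"
    and bracket_scale_right: "bracket x (a *s y) = a *s bracket x y"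
    and bracket_self: "bracket x x = 0"
    and jacobi: "bracket x (bracket y z) + bracket y (bracket z x) + bracket z (bracket x y) = 0"
begin

definition finite_dimensional :: bool where
  "finite_dimensional \<longleftrightarrow> (\<exists>B. finite B \<and> span B = UNIV)"

definition commutator_space :: "'v set \<Rightarrow> 'v set \<Rightarrow> 'v set" where
  "commutator_space A B = span {bracket x y | x y. x \<in> A \<and> y \<in> B}"

text \<open>
  The lower central series of a subalgebra \<open>S\<close> is taken inside \<open>S\<close>, that is, with \<open>S\<close>
  regarded as a Lie algebra in its own right; it is indexed so that the zeroth term is \<open>S\<close>.
\<close>

primrec lower_central :: "'v set \<Rightarrow> nat \<Rightarrow> 'v set" where
  "lower_central S 0 = S"
| "lower_central S (Suc i) = commutator_space S (lower_central S i)"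

definition nilpotent :: "'v set \<Rightarrow> bool" where
  "nilpotent S \<longleftrightarrow> (\<exists>m. lower_central S m = {0})"

text \<open>
  The guard \<open>c > 0\<close> gives the zero algebra class \<open>0\<close>. For algebras that are not nilpotent
  the value is unspecified.
\<close>

definition nilpotency_class :: "'v set \<Rightarrow> nat" where
  "nilpotency_class S =
    (THE c. lower_central S c = {0} \<and> (c > 0 \<longrightarrow> lower_central S (c - 1) \<noteq> {0}))"

definition coclass :: "'v set \<Rightarrow> int" where
  "coclass S = int (dim S) - int (nilpotency_class S)"

definition derived :: "'v set" where
  "derived = commutator_space UNIV UNIV"

definition center :: "'v set" where
  "center = {x. \<forall>y. bracket x y = 0}"

definition second_center :: "'v set" where
  "second_center = {x. \<forall>y. bracket x y \<in> center}"

definition automorphisms :: "('v \<Rightarrow> 'v) set" where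
  "automorphisms =
    {f. Vector_Spaces.linear scale scale f \<and> bij f \<and> (\<forall>x y. f (bracket x y) = bracket (f x) (f y))}"

definition aut_group :: "('v \<Rightarrow> 'v) monoid" where
  "aut_group = \<lparr>carrier = automorphisms, mult = (\<circ>), one = id\<rparr>"

definition commuting_automorphisms :: "('v \<Rightarrow> 'v) set" where
  "commuting_automorphisms = {f \<in> automorphisms. \<forall>x. bracket (f x) x = 0}"

lemma lower_central_zero_upward:
  assumes "lower_central S m = {0}" and "m \<le> k"
  shows "lower_central S k = {0}"
  using assms(2)
proof (induction k rule: dec_induct)
  case base
  show ?case by (rule assms(1))
next
  case (step k)
  have "bracket x 0 = 0" for x
    using bracket_scale_right[of x 0 0] by simp
  then have "{bracket x y | x y. x \<in> S \<and> y \<in> {0}} \<subseteq> {0}"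
    by blast
  then have "span {bracket x y | x y. x \<in> S \<and> y \<in> {0}} \<subseteq> {0}"
    by (rule span_minimal[OF _ subspace_single_0])
  moreover have "0 \<in> span {bracket x y | x y. x \<in> S \<and> y \<in> {0}}"
    by (rule span_zero)
  ultimately have "span {bracket x y | x y. x \<in> S \<and> y \<in> {0}} = {0}"
    by blast
  then show ?case
    by (simp only: lower_central.simps step.IH commutator_space_def)
qed

lemma nilpotency_class_eq_Least:
  assumes "nilpotent S"
  shows "nilpotency_class S = (LEAST c. lower_central S c = {0})"
  unfolding nilpotency_class_def
proof (rule the_equality)
  let ?P = "\<lambda>c. lower_central S c = {0}"
  have "?P (LEAST c. ?P c)"
    using assms unfolding nilpotent_def by (rule LeastI_ex)
  then show "?P (LEAST c. ?P c) \<and> (0 < (LEAST c. ?P c) \<longrightarrow> \<not> ?P ((LEAST c. ?P c) - 1))"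
    using not_less_Least[of "(LEAST c. ?P c) - 1" ?P] by auto
  fix c assume c: "?P c \<and> (c > 0 \<longrightarrow> \<not> ?P (c - 1))"
  have "c \<le> m" if m: "?P m" for m
  proof (rule ccontr)
    assume "\<not> c \<le> m"
    then have "m \<le> c - 1" and "c > 0"
      by linarith+
    then show False
      using lower_central_zero_upward[OF m] c by blast
  qed
  moreover have "?P c"
    using c by (rule conjunct1)
  ultimately show "c = (LEAST c. ?P c)"
    by (rule Least_equality[symmetric, rotated])
qed

lemma group_aut_group: "group aut_group"
proof (rule groupI)
  show "\<one>\<^bsub>aut_group\<^esub> \<in> carrier aut_group"
    by (auto simp: aut_group_def automorphisms_def linear_id)
next
  fix f g assume "f \<in> carrier aut_group" "g \<in> carrier aut_group"
  then show "f \<otimes>\<^bsub>aut_group\<^esub> g \<in> carrier aut_group"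
    by (auto simp: aut_group_def automorphisms_def intro: Vector_Spaces.linear_compose bij_comp)
next
  fix f assume "f \<in> carrier aut_group"
  then have lin: "Vector_Spaces.linear scale scale f" and bij: "bij f"
    and br: "\<And>x y. f (bracket x y) = bracket (f x) (f y)"
    by (auto simp: aut_group_def automorphisms_def)
  interpret f: Vector_Spaces.linear scale scale f by (rule lin)
  let ?g = "inv_into UNIV f"
  have fg: "f (?g x) = x" for x using bij by (simp add: bij_is_surj surj_f_inv_f)
  have inj: "f x = f y \<Longrightarrow> x = y" for x y using bij by (simp add: bij_is_inj inj_eq)
  have "Vector_Spaces.linear scale scale ?g"
    by unfold_locales (rule inj, simp add: fg f.add f.scale)+
  moreover have "?g (bracket x y) = bracket (?g x) (?g y)" for x y
    by (rule inj) (simp add: fg br)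
  ultimately have "?g \<in> carrier aut_group"
    using bij by (auto simp: aut_group_def automorphisms_def bij_imp_bij_inv)
  moreover have "?g \<circ> f = id"
    using bij by (simp add: bij_is_inj)
  ultimately show "\<exists>h\<in>carrier aut_group. h \<otimes>\<^bsub>aut_group\<^esub> f = \<one>\<^bsub>aut_group\<^esub>"
    by (auto simp: aut_group_def)
qed (auto simp: aut_group_def)

end

end

theory Submission
  imports Defs
begin

text \<open>
  Commuting automorphisms are self-adjoint, \<open>[f x, y] = [x, f y]\<close>, so \<open>f \<circ> g\<close> is again commuting
  as soon as \<open>[f x, g x] = 0\<close> for all \<open>x\<close>. Shifting powers of \<open>f\<close> between the three slots of the Jacobi
  identity gives \<open>4 ([z, [f x, y]] - [z, [x, y]]) = 0\<close>, so in characteristic other than 2 the map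
  \<open>f - 1\<close> sends \<open>L\<close> into \<open>Z\<^sub>2(L)\<close>, and it is enough that \<open>Z\<^sub>2(L)\<close> is abelian.

  If the class is at least 3 and \<open>Z\<^sub>2(L)\<close> is not abelian, then \<open>Z\<^sub>2(L) \<inter> L'\<close> and \<open>Z(L)\<close> lie in the center
  of \<open>Z\<^sub>2(L)\<close>, which has codimension at least 2 in \<open>Z\<^sub>2(L)\<close> and properly contains \<open>Z(L)\<close>. Also
  \<open>Z\<^sub>2(L) + L'\<close> has codimension at least 2 in \<open>L\<close>. For coclass 3, counting dimensions along the lower central
  series leaves only \<open>dim Z(L) = 1\<close>, \<open>dim Z\<^sub>2(L) = 4\<close>, \<open>dim L' = n - 4\<close>. For \<open>n = 5\<close>
  with \<open>dim Z(L) \<ge> 2\<close>, the centralizer of a noncentral \<open>x\<close> is abelian, and it contains \<open>f x\<close> and \<open>g x\<close>.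
\<close>

section \<open>Brackets, centers and commutator spaces\<close>

context lie_algebra
begin

lemma bracket_zero_left [simp]: "bracket 0 y = 0"
  using bracket_scale_left[of 0 0 y] by simp

lemma bracket_zero_right [simp]: "bracket y 0 = 0"
  using bracket_scale_right[of y 0 0] by simp

lemma bracket_anticommute: "bracket x y = - bracket y x"
proof -
  have "bracket x (x + y) + bracket y (x + y) = 0"
    using bracket_self[of "x + y"] unfolding bracket_add_left .
  then show ?thesis
    by (simp add: bracket_add_right bracket_self eq_neg_iff_add_eq_0)
qed

lemma bracket_eq_0_commute: "bracket x y = 0 \<longleftrightarrow> bracket y x = 0"
  using bracket_anticommute[of x y] by simp

lemma subspace_centralizer: "subspace {y. bracket x y = 0}"
  by (auto simp: subspace_def bracket_add_right bracket_scale_right)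

lemma subspace_center: "subspace center"
  by (auto simp: subspace_def center_def bracket_add_left bracket_scale_left)

lemma bracket_center_right: "x \<in> center \<Longrightarrow> bracket y x = 0"
  using bracket_eq_0_commute[of y x] by (simp add: center_def)

lemma span_subspace_id: "subspace S \<Longrightarrow> span S = S"
  by simp

lemma subspace_second_center: "subspace second_center"
  using subspace_center
  by (auto simp: subspace_def second_center_def bracket_add_left bracket_scale_left)

lemma center_subset_second_center: "center \<subseteq> second_center"
  by (auto simp: center_def second_center_def)

lemma bracket_second_center_left: "x \<in> second_center \<Longrightarrow> bracket x y \<in> center"
  by (simp add: second_center_def)

lemma bracket_second_center_right: "x \<in> second_center \<Longrightarrow> bracket y x \<in> center"
  using bracket_second_center_left[of x y] bracket_anticommute[of y x]
    subspace_neg[OF subspace_center] by simp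

lemma subspace_commutator_space: "subspace (commutator_space A B)"
  by (simp add: commutator_space_def)

lemma bracket_in_commutator_space:
  "x \<in> A \<Longrightarrow> y \<in> B \<Longrightarrow> bracket x y \<in> commutator_space A B"
  unfolding commutator_space_def by (rule span_base) blast

lemma commutator_space_subset:
  assumes "subspace S" and "\<And>x y. x \<in> A \<Longrightarrow> y \<in> B \<Longrightarrow> bracket x y \<in> S"
  shows "commutator_space A B \<subseteq> S"
  unfolding commutator_space_def using assms by (intro span_minimal) auto

lemma commutator_space_mono: "B \<subseteq> C \<Longrightarrow> commutator_space A B \<subseteq> commutator_space A C"
  by (intro commutator_space_subset subspace_commutator_space bracket_in_commutator_space) auto

text \<open>Sums of subspaces are written throughout as spans of unions; additivity of the bracket
  in its second argument splits it over the two summands.\<close>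

lemma commutator_space_span_Un:
  assumes "subspace A" "subspace B" "S \<subseteq> span (A \<union> B)"
  shows "commutator_space UNIV S \<subseteq> span (commutator_space UNIV A \<union> commutator_space UNIV B)"
proof (rule commutator_space_subset[OF subspace_span])
  fix x y assume "y \<in> S"
  then obtain a b where "y = a + b" "a \<in> A" "b \<in> B"
    using assms by (auto simp: span_Un span_subspace_id)
  then show "bracket x y \<in> span (commutator_space UNIV A \<union> commutator_space UNIV B)"
    by (simp add: bracket_add_right span_add span_base bracket_in_commutator_space)
qed

lemma commutator_space_second_center: "commutator_space UNIV second_center \<subseteq> center"
  by (intro commutator_space_subset subspace_center bracket_second_center_right)

lemma commutator_space_center: "commutator_space UNIV center \<subseteq> {0}"
  by (intro commutator_space_subset) (auto simp: bracket_center_right)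

section \<open>Lower central series and its relation to the centers\<close>

lemma subspace_lower_central: "subspace (lower_central UNIV i)"
  by (cases i) (simp_all add: subspace_commutator_space)

lemma lower_central_Suc_subset: "lower_central UNIV (Suc i) \<subseteq> lower_central UNIV i"
proof (induction i)
  case (Suc i)
  then show ?case
    using commutator_space_mono by auto
qed simp

lemma lower_central_antimono:
  "i \<le> j \<Longrightarrow> lower_central UNIV j \<subseteq> lower_central UNIV i"
  using lift_Suc_antimono_le[of "lower_central UNIV"] lower_central_Suc_subset by blast

text \<open>Bracketing the inclusion with L again and again keeps term \<open>i\<close> inside every
  later term, and by nilpotency some later term is zero.\<close>

lemma lower_central_eq_0_if_stable:
  assumes "nilpotent UNIV" "lower_central UNIV i \<subseteq> lower_central UNIV (Suc i)"
  shows "lower_central UNIV i = {0}"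
proof -
  have sub: "lower_central UNIV i \<subseteq> lower_central UNIV (i + k)" for k
  proof (induction k)
    case (Suc k)
    from commutator_space_mono[OF Suc]
    have "lower_central UNIV (Suc i) \<subseteq> lower_central UNIV (i + Suc k)"
      by simp
    with assms(2) show ?case
      by blast
  qed simp
  obtain m where "lower_central UNIV m = {0}"
    using assms(1) by (auto simp: nilpotent_def)
  then have "lower_central UNIV (i + m) = {0}"
    by (rule lower_central_zero_upward) simp
  with sub[of m] subspace_0[OF subspace_lower_central, of i] show ?thesis
    by auto
qed

text \<open>One bracket with L annihilates the central summand, so term \<open>Suc i\<close> lies in
  the next one and is stable.\<close>

lemma lower_central_eq_0_if_subset_center:
  assumes "nilpotent UNIV"
    and "lower_central UNIV i \<subseteq> span (lower_central UNIV (Suc i) \<union> center)"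
  shows "lower_central UNIV (Suc i) = {0}"
proof -
  let ?g = "lower_central UNIV"
  have "?g (Suc i) \<subseteq> span (?g (Suc (Suc i)) \<union> commutator_space UNIV center)"
    using commutator_space_span_Un[OF subspace_lower_central subspace_center assms(2)] by simp
  also have "\<dots> \<subseteq> span (?g (Suc (Suc i)))"
    using commutator_space_center subspace_0[OF subspace_lower_central, of "Suc (Suc i)"]
    by (intro span_mono) blast
  also have "\<dots> = ?g (Suc (Suc i))"
    using subspace_lower_central span_eq_iff by blast
  finally show ?thesis
    by (rule lower_central_eq_0_if_stable[OF assms(1)])
qed

text \<open>One bracket with L sends the summand \<open>second_center\<close> into
  \<open>center\<close>, which reduces to the central case at index \<open>Suc i\<close>.\<close>

lemma lower_central_eq_0_if_subset_second_center:
  assumes "nilpotent UNIV"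
    and "lower_central UNIV i \<subseteq> span (lower_central UNIV (Suc i) \<union> second_center)"
  shows "lower_central UNIV (Suc (Suc i)) = {0}"
proof (rule lower_central_eq_0_if_subset_center[OF assms(1)])
  let ?g = "lower_central UNIV"
  have "?g (Suc i) \<subseteq> span (?g (Suc (Suc i)) \<union> commutator_space UNIV second_center)"
    using commutator_space_span_Un[OF subspace_lower_central subspace_second_center assms(2)]
    by simp
  also have "\<dots> \<subseteq> span (?g (Suc (Suc i)) \<union> center)"
    using commutator_space_second_center by (intro span_mono) blast
  finally show "?g (Suc i) \<subseteq> span (?g (Suc (Suc i)) \<union> center)" .
qed

lemma lower_central_subset_center:
  assumes "lower_central UNIV (Suc i) = {0}"
  shows "lower_central UNIV i \<subseteq> center"
proof
  fix x assume "x \<in> lower_central UNIV i"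
  then have "bracket y x = 0" for y
    using assms bracket_in_commutator_space[of y UNIV x] by auto
  then show "x \<in> center"
    using bracket_eq_0_commute by (auto simp: center_def)
qed

lemma lower_central_subset_second_center:
  assumes "lower_central UNIV (Suc (Suc i)) = {0}"
  shows "lower_central UNIV i \<subseteq> second_center"
proof
  fix x assume x: "x \<in> lower_central UNIV i"
  have "bracket y x \<in> center" for y
    using lower_central_subset_center[OF assms] bracket_in_commutator_space[of y UNIV x] x by auto
  then have "- bracket x y \<in> center" for y
    by (metis bracket_anticommute)
  then show "x \<in> second_center"
    using subspace_neg[OF subspace_center] unfolding second_center_def by force
qed

text \<open>For a generator [x, y] of L', two of the three Jacobi terms are brackets with the
  central elements [y, z] and [z, x], so the third vanishes too.\<close>

lemma second_center_commutes_derived: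
  assumes "z \<in> second_center" "w \<in> derived"
  shows "bracket z w = 0"
proof -
  have "commutator_space UNIV UNIV \<subseteq> {w. bracket z w = 0}"
  proof (rule commutator_space_subset[OF subspace_centralizer])
    fix x y
    have "bracket x (bracket y z) = 0" "bracket y (bracket z x) = 0"
      using assms(1) bracket_second_center_left bracket_second_center_right
      by (auto simp: center_def bracket_eq_0_commute)
    then show "bracket x y \<in> {w. bracket z w = 0}"
      using jacobi[of z x y] by simp
  qed
  then show ?thesis
    using assms(2) by (auto simp: derived_def)
qed

text \<open>[Z_2, Z_2] is central in L, so a further bracket kills it. This bounds the class of Z_2
  by 2.\<close>

lemma lower_central_second_center: "lower_central second_center 2 = {0}"
proof -
  let ?z = "commutator_space second_center second_center"
  have "?z \<subseteq> center"
    by (intro commutator_space_subset subspace_center bracket_second_center_left)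
  then have "commutator_space second_center ?z \<subseteq> {0}"
    by (intro commutator_space_subset) (auto simp: bracket_center_right)
  then show ?thesis
    using subspace_0[OF subspace_commutator_space] by (auto simp: numeral_2_eq_2)
qed

section \<open>Nilpotency class and commutativity\<close>

lemma nilpotency_class_props:
  assumes "nilpotent S"
  shows "lower_central S (nilpotency_class S) = {0}"
    and "i < nilpotency_class S \<Longrightarrow> lower_central S i \<noteq> {0}"
proof -
  show "lower_central S (nilpotency_class S) = {0}"
    using assms LeastI_ex[of "\<lambda>c. lower_central S c = {0}"]
    by (simp add: nilpotency_class_eq_Least nilpotent_def)
  show "lower_central S i \<noteq> {0}" if "i < nilpotency_class S"
    using assms that not_less_Least by (simp add: nilpotency_class_eq_Least)
qed

lemma nilpotency_class_le_1_imp_abelian: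
  assumes "nilpotent S" "nilpotency_class S \<le> 1" "x \<in> S" "y \<in> S"
  shows "bracket x y = 0"
proof -
  have "lower_central S 1 = {0}"
    using nilpotency_class_props(1)[OF assms(1)] assms(2) by (rule lower_central_zero_upward)
  with bracket_in_commutator_space[OF assms(3,4)] show ?thesis
    by simp
qed

lemma second_center_abelian_if_class_neq_2:
  assumes "nilpotency_class second_center \<noteq> 2" "x \<in> second_center" "y \<in> second_center"
  shows "bracket x y = 0"
proof (rule nilpotency_class_le_1_imp_abelian[of second_center])
  show nil: "nilpotent second_center"
    using lower_central_second_center by (auto simp: nilpotent_def)
  show "nilpotency_class second_center \<le> 1"
    using nilpotency_class_props(2)[OF nil, of 2] lower_central_second_center assms(1) by force
qed (use assms in auto)

end

section \<open>Dimension counts\<close>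

locale finite_dim_lie_algebra =
  lie_algebra scale bracket + finite_dimensional_vector_space scale Basis
  for scale :: "'k::field \<Rightarrow> 'v::ab_group_add \<Rightarrow> 'v" (infixr "*s" 75)
    and bracket Basis
begin

lemma dim_strict_mono: "subspace S \<Longrightarrow> subspace T \<Longrightarrow> S \<subset> T \<Longrightarrow> dim S < dim T"
  using dim_psubset[of S T] by (simp add: span_subspace_id)

text \<open>If \<open>S = T\<close>, the vector is 0, so codimensions 0 and 1 can be treated
  alike.\<close>

lemma codim_one_cases:
  assumes "subspace S" "subspace T" "S \<subseteq> T" "dim T \<le> dim S + 1"
  obtains x where "T = span (insert x S)"
proof (cases "S = T")
  case True
  then have "T = span (insert 0 S)"
    using assms(1) by (simp add: span_subspace_id)
  then show ?thesis
    by (rule that)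
next
  case False
  then obtain x where x: "x \<in> T" "x \<notin> S"
    using assms(3) by blast
  have "span (insert x S) = T"
  proof (rule subspace_dim_equal[OF subspace_span assms(2)])
    show "span (insert x S) \<subseteq> T"
      using x assms(2,3) by (intro span_minimal) auto
    have "x \<notin> span S"
      using x assms(1) by (simp add: span_subspace_id)
    then show "dim T \<le> dim (span (insert x S))"
      using assms(4) by (simp add: dim_insert)
  qed
  then show ?thesis
    using that by blast
qed

text \<open>The Lie analogue of a group with cyclic central quotient being abelian: in the bracket
  of a x + s and b x + t only a multiple of [x, x] could survive.\<close>

lemma abelian_if_codim_one_central:
  assumes "subspace S" "subspace T" "S \<subseteq> T" "dim T \<le> dim S + 1"
    and central: "\<And>s t. s \<in> S \<Longrightarrow> t \<in> T \<Longrightarrow> bracket s t = 0"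
    and "u \<in> T" "v \<in> T"
  shows "bracket u v = 0"
proof -
  obtain x where x: "T = span (insert x S)"
    using codim_one_cases[OF assms(1-4)] .
  have S: "span S = S"
    using assms(1) by (rule span_subspace_id)
  obtain a b where ab: "u - a *s x \<in> S" "v - b *s x \<in> S"
    using assms(6,7) by (auto simp: x span_breakdown_eq S)
  have xT: "x \<in> T"
    by (simp add: x span_base)
  define s t where "s = u - a *s x" and "t = v - b *s x"
  have "s \<in> S" "t \<in> S" "u = a *s x + s" "v = b *s x + t"
    using ab by (simp_all add: s_def t_def)
  moreover from this have "bracket s x = 0" "bracket x t = 0" "bracket s t = 0"
    using central xT assms(3) bracket_eq_0_commute by blast+
  ultimately show ?thesis
    by (simp add: bracket_add_left bracket_add_right bracket_scale_left bracket_scale_right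
        bracket_self)
qed

text \<open>By stability every inclusion above term \<open>c\<close> is strict and costs at least
  one dimension; the count runs downward from \<open>j = c\<close>.\<close>

lemma dim_lower_central_ge:
  assumes "lower_central UNIV c = {0}" "\<And>i. i < c \<Longrightarrow> lower_central UNIV i \<noteq> {0}" "j \<le> c"
  shows "c \<le> j + dim (lower_central UNIV j)"
  using assms(3)
proof (induction j rule: inc_induct)
  case (step j)
  have "nilpotent UNIV"
    using assms(1) by (auto simp: nilpotent_def)
  then have "lower_central UNIV (Suc j) \<subset> lower_central UNIV j"
    using lower_central_eq_0_if_stable[of j] assms(2) step.hyps lower_central_Suc_subset by blast
  from dim_strict_mono[OF subspace_lower_central subspace_lower_central this] step.IH
  show ?case
    by linarith
qed simp

text \<open>The same strict descent, taken modulo Z_2. It starts at \<open>m + 1\<close>, where only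
  the dimension of Z_2 is counted.\<close>

lemma dim_lower_central_plus_second_center_ge:
  assumes "lower_central UNIV (m + 3) = {0}"
    and "\<And>i. i < m + 3 \<Longrightarrow> lower_central UNIV i \<noteq> {0}" "j \<le> m + 1"
  shows "dim second_center + (m + 1) \<le> j + dim (span (lower_central UNIV j \<union> second_center))"
  using assms(3)
proof (induction j rule: inc_induct)
  case base
  show ?case
    using dim_subset[of second_center "lower_central UNIV (m + 1) \<union> second_center"]
    by (simp del: lower_central.simps)
next
  case (step j)
  let ?P = "\<lambda>i. span (lower_central UNIV i \<union> second_center)"
  have "nilpotent UNIV"
    using assms(1) by (auto simp: nilpotent_def)
  \<comment> \<open>Otherwise term \<open>j + 2\<close> would be zero, although
    \<open>j \<le> m\<close> keeps it below \<open>m + 3\<close>.\<close>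
  then have "\<not> lower_central UNIV j \<subseteq> ?P (Suc j)"
    using lower_central_eq_0_if_subset_second_center[of j] assms(2)[of "Suc (Suc j)"] step.hyps
    by auto
  moreover have "?P (Suc j) \<subseteq> ?P j"
    using lower_central_Suc_subset by (intro span_mono Un_mono order_refl)
  moreover have "lower_central UNIV j \<subseteq> ?P j"
    using span_superset by blast
  ultimately have "?P (Suc j) \<subset> ?P j"
    by blast
  from dim_strict_mono[OF subspace_span subspace_span this] step.IH
  show ?case
    by linarith
qed

text \<open>In codimension at most 1, L is spanned by some x and P = L' + Z_2. As [x, x] = 0, L'
  then comes from [L, P], which lies in term 2 plus the center, and this forces term 2 to
  vanish.\<close>

lemma codim_second_center_plus_derived:
  assumes "nilpotent UNIV" "lower_central UNIV 2 \<noteq> {0}"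
  shows "dim (span (derived \<union> second_center)) + 2 \<le> dim UNIV"
proof (rule ccontr)
  let ?P = "span (derived \<union> second_center)"
  let ?Q = "span (lower_central UNIV 2 \<union> center)"
  assume "\<not> ?thesis"
  then obtain x where x: "UNIV = span (insert x ?P)"
    using codim_one_cases[OF subspace_span[of "derived \<union> second_center"] subspace_UNIV] by force
  have der: "lower_central UNIV (Suc 0) = derived"
    by (simp add: derived_def)
  have P: "bracket y p \<in> ?Q" if "p \<in> ?P" for y p
  proof -
    have "commutator_space UNIV ?P \<subseteq>
        span (commutator_space UNIV derived \<union> commutator_space UNIV second_center)"
      using subspace_commutator_space subspace_second_center
      by (intro commutator_space_span_Un order_refl) (auto simp: derived_def)
    also have "\<dots> \<subseteq> ?Q"
      using commutator_space_second_center
      by (intro span_mono) (auto simp: numeral_2_eq_2 derived_def)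
    finally show ?thesis
      using bracket_in_commutator_space[of y UNIV p] that by auto
  qed
  have "commutator_space UNIV UNIV \<subseteq> ?Q"
  proof (rule commutator_space_subset[OF subspace_span])
    fix u v
    obtain a b where ab: "u - a *s x \<in> ?P" "v - b *s x \<in> ?P"
      using x span_breakdown_eq[of u x ?P] span_breakdown_eq[of v x ?P]
      by (metis UNIV_I span_span)
    define s t where "s = u - a *s x" and "t = v - b *s x"
    have st: "s \<in> ?P" "t \<in> ?P" "u = a *s x + s" "v = b *s x + t"
      using ab by (simp_all add: s_def t_def)
    \<comment> \<open>With [x, x] gone, each remaining bracket has an argument in
      \<open>?P\<close>.\<close>
    have "bracket u v = bracket u t - b *s bracket x s"
      unfolding st(3,4) bracket_anticommute[of x s]
      by (simp add: bracket_add_left bracket_add_right bracket_scale_left bracket_scale_right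
          bracket_self)
    then show "bracket u v \<in> ?Q"
      using P st by (simp add: span_diff span_scale)
  qed
  then have "lower_central UNIV (Suc 0) \<subseteq> span (lower_central UNIV (Suc (Suc 0)) \<union> center)"
    by (simp add: numeral_2_eq_2)
  from lower_central_eq_0_if_subset_center[OF assms(1) this] assms(2) show False
    by (simp add: numeral_2_eq_2)
qed

text \<open>Class \<open>m + 3\<close> in dimension \<open>m + 6\<close> is coclass 3, and
  \<open>m + 2\<close> is n - 4. Lower and upper dimension bounds meet exactly at these
  values.\<close>

lemma dims_if_second_center_nonabelian:
  assumes zero: "lower_central UNIV (m + 3) = {0}"
    and nonzero: "\<And>i. i < m + 3 \<Longrightarrow> lower_central UNIV i \<noteq> {0}"
    and dim: "dim UNIV = m + 6"
    and uv: "u \<in> second_center" "v \<in> second_center" "bracket u v \<noteq> 0"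
  shows "dim center = 1 \<and> dim second_center = 4 \<and> dim derived = m + 2"
proof -
  have nil: "nilpotent UNIV"
    using zero by (auto simp: nilpotent_def)
  have der: "derived = lower_central UNIV 1"
    by (simp add: derived_def)
  \<comment> \<open>\<open>S\<close> is the center of \<open>second_center\<close> as a Lie algebra
    in its own right; it separates \<open>center\<close> from \<open>second_center\<close> in the
    count.\<close>
  define S where "S = {z \<in> second_center. \<forall>t \<in> second_center. bracket z t = 0}"
  have S: "subspace S"
    using subspace_second_center
    by (auto simp: S_def subspace_def bracket_add_left bracket_scale_left)
  have "\<not> dim second_center \<le> dim S + 1"
    using abelian_if_codim_one_central[OF S subspace_second_center] uv S_def by blast
  then have 1: "dim S + 2 \<le> dim second_center"
    by linarith
  have derS: "derived \<inter> second_center \<subseteq> S"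
    using second_center_commutes_derived bracket_eq_0_commute by (auto simp: S_def)
  have "lower_central UNIV (m + 1) \<subseteq> S"
    using derS lower_central_subset_second_center[of "m + 1"] zero
      lower_central_antimono[of 1 "m + 1"]
    by (auto simp: der eval_nat_numeral)
  \<comment> \<open>This term lies in \<open>S\<close>; were it central, term \<open>m + 2\<close>
    would vanish. Hence \<open>center\<close> is strictly smaller than \<open>S\<close>.\<close>
  moreover have "\<not> lower_central UNIV (m + 1) \<subseteq> center"
  proof
    assume "lower_central UNIV (m + 1) \<subseteq> center"
    then have "lower_central UNIV (m + 1) \<subseteq> span (lower_central UNIV (Suc (m + 1)) \<union> center)"
      using span_superset by blast
    from lower_central_eq_0_if_subset_center[OF nil this] nonzero[of "Suc (m + 1)"] show False
      by simp
  qed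
  moreover have "center \<subseteq> S"
    using center_subset_second_center by (auto simp: S_def center_def)
  ultimately have 2: "dim center < dim S"
    using subspace_center S by (intro dim_strict_mono) auto
  have "lower_central UNIV (m + 2) \<subseteq> center"
    using zero by (intro lower_central_subset_center) (simp add: eval_nat_numeral)
  then have "\<not> center \<subseteq> {0}"
    using nonzero[of "m + 2"] subspace_0[OF subspace_lower_central, of "m + 2"] by auto
  then have 3: "dim center > 0"
    using dim_eq_0 by blast
  have "dim (derived \<inter> second_center) \<le> dim S"
    using derS by (rule dim_subset)
  moreover have "dim (span (derived \<union> second_center)) + dim (derived \<inter> second_center)
      = dim derived + dim second_center"
    using dim_sums_Int[of derived second_center] subspace_second_center
      subspace_commutator_space[of UNIV UNIV]
    by (simp add: span_Un derived_def span_subspace_id del: dim_span)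
  moreover have "lower_central UNIV 2 \<noteq> {0}"
    using nonzero[of 2] by simp
  then have "dim (span (derived \<union> second_center)) + 2 \<le> m + 6"
    using codim_second_center_plus_derived[OF nil] dim by simp
  moreover have "m + 2 \<le> dim derived"
    using dim_lower_central_ge[OF zero nonzero, of 1] by (simp add: der del: lower_central.simps)
  moreover have "dim second_center + m \<le> dim (span (derived \<union> second_center))"
    using dim_lower_central_plus_second_center_ge[OF zero nonzero, of 1]
    by (simp add: der del: lower_central.simps)
  \<comment> \<open>L' + Z_2 has dimension at least \<open>dim second_center + m\<close> and at most
    \<open>m + 4\<close>, so Z_2 has dimension at most 4; facts 3, 2 and 1 give at least 1, 2 and 4
    for \<open>center\<close>, \<open>S\<close> and Z_2. All are equalities, and the formula for sum
    and intersection bounds \<open>dim derived\<close> by \<open>m + 2\<close>.\<close>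
  ultimately show ?thesis
    using 1 2 3 by linarith
qed

text \<open>The centralizer of x is proper, so its dimension is at most
  \<open>dim center + 2\<close>. The span of x and the center is central in it and has dimension
  \<open>dim center + 1\<close>, leaving codimension at most 1.\<close>

lemma centralizer_abelian_if_small_center:
  assumes dims: "dim UNIV \<le> dim center + 3" and x: "x \<notin> center"
    and uv: "bracket x u = 0" "bracket x v = 0"
  shows "bracket u v = 0"
proof -
  let ?C = "{y. bracket x y = 0}" and ?S = "span (insert x center)"
  have "?C \<subset> UNIV"
    using x by (auto simp: center_def)
  from dim_strict_mono[OF subspace_centralizer subspace_UNIV this]
  have "dim ?C \<le> dim center + 2"
    using dims by linarith
  moreover have "dim ?S = dim center + 1"
    using x subspace_center by (simp add: dim_insert span_subspace_id)
  ultimately have dim: "dim ?C \<le> dim ?S + 1"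
    by linarith
  have sub: "?S \<subseteq> ?C"
    using bracket_self bracket_eq_0_commute
    by (intro span_minimal subspace_centralizer) (auto simp: center_def)
  have central: "bracket s t = 0" if s: "s \<in> ?S" and t: "t \<in> ?C" for s t
  proof -
    have "?S \<subseteq> {s. bracket t s = 0}"
      using t bracket_eq_0_commute
      by (intro span_minimal subspace_centralizer) (auto simp: center_def)
    with s bracket_eq_0_commute show ?thesis
      by blast
  qed
  show ?thesis
    using abelian_if_codim_one_central[OF subspace_span subspace_centralizer sub dim central] uv
    by blast
qed

end

section \<open>Commuting automorphisms and their displacements\<close>

lemma quadruple_eq_0:
  fixes a2 a3 a4 b2 b3 b4 c2 c3 c4 :: "'a::ab_group_add"
  assumes "a3 + b3 + c2 = 0" "a3 + b2 + c3 = 0" "a2 + b3 + c3 = 0"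
    and "a4 + b2 + c2 = 0" "a2 + b4 + c2 = 0" "a2 + b2 + c4 = 0" "a4 + b4 + c4 = 0"
  shows "(a3 - a2) + (a3 - a2) + (a3 - a2) + (a3 - a2) = 0"
proof -
  \<comment> \<open>The letters stand for the three cyclic Jacobi terms, the digits for the power of
    the automorphism inserted. The gap \<open>h\<close> is the same in all three terms. The last
    four relations make twice \<open>a2 + b2 + c2\<close> vanish, and the first makes this sum equal
    to -2h; no division is involved.\<close>
  define h where "h = a3 - a2"
  have a3: "a3 = a2 + h"
    by (simp add: h_def)
  have "a3 + b2 + c3 = a2 + b3 + c3"
    using assms by simp
  then have b3: "b3 = b2 + h"
    by (simp add: h_def algebra_simps)
  have "a3 + b3 + c2 = a2 + b3 + c3"
    using assms by simp
  then have c3: "c3 = c2 + h"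
    by (simp add: h_def algebra_simps)
  have "a4 + b4 + c4 + (a2 + b2 + c2) + (a2 + b2 + c2) =
      (a4 + b2 + c2) + (a2 + b4 + c2) + (a2 + b2 + c4)"
    by (simp only: ac_simps)
  then have double: "(a2 + b2 + c2) + (a2 + b2 + c2) = 0"
    using assms(4-7) by simp
  have sum: "a2 + b2 + c2 + (h + h) = 0"
    using assms(1) unfolding a3 b3 by (simp only: ac_simps)
  have "h + h + h + h + ((a2 + b2 + c2) + (a2 + b2 + c2)) =
      (a2 + b2 + c2 + (h + h)) + (a2 + b2 + c2 + (h + h))"
    by (simp only: ac_simps)
  then have "h + h + h + h = 0"
    unfolding sum double by simp
  then show ?thesis
    by (simp add: h_def)
qed

context lie_algebra
begin

text \<open>Polarization of [f z, z] = 0 at z = x + y.\<close>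

lemma commuting_automorphism_selfadjoint:
  assumes "f \<in> commuting_automorphisms"
  shows "bracket (f x) y = bracket x (f y)"
proof -
  interpret f: Vector_Spaces.linear scale scale f
    using assms by (simp add: commuting_automorphisms_def automorphisms_def)
  have "bracket (f z) z = 0" for z
    using assms by (simp add: commuting_automorphisms_def)
  from this[of "x + y"] this[of x] this[of y] have "bracket (f x) y + bracket (f y) x = 0"
    by (simp add: f.add bracket_add_left bracket_add_right add.commute)
  then show ?thesis
    by (simp add: add_eq_0_iff2 bracket_anticommute[of x "f y"])
qed

lemma commuting_automorphism_displacement:
  assumes char: "CHAR('k) \<noteq> 2" and f: "f \<in> commuting_automorphisms"
  shows "f x - x \<in> second_center"
proof -
  interpret f: Vector_Spaces.linear scale scale f
    using f by (simp add: commuting_automorphisms_def automorphisms_def)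
  have two: "(2 :: 'k) \<noteq> 0"
  proof
    assume "(2 :: 'k) = 0"
    then have "CHAR('k) dvd 2"
      using of_nat_eq_0_iff_char_dvd[where 'a = 'k, of 2] by simp
    then have "CHAR('k) \<le> 2" "CHAR('k) \<noteq> 0"
      using dvd_imp_le[of "CHAR('k)" 2] by (auto intro!: Nat.gr0I)
    then show False
      using char CHAR_not_1'[where 'a = 'k] by linarith
  qed
  have four: "(4 :: 'k) \<noteq> 0"
    using two mult_eq_0_iff[of "2 :: 'k" 2] by simp
  have hom: "f (bracket x y) = bracket (f x) (f y)" for x y
    using f by (simp add: commuting_automorphisms_def automorphisms_def)
  have "surj f"
    using f by (simp add: commuting_automorphisms_def automorphisms_def bij_is_surj)
  note adj = commuting_automorphism_selfadjoint[OF f]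
  \<comment> \<open>Self-adjointness and multiplicativity move every power of \<open>f\<close> into the middle slot, where an
    \<open>f\<close> on the outer argument counts twice.\<close>
  define F where "F i x y z = bracket x (bracket ((f ^^ i) y) z)" for i x y z
  have F3: "F i x y (f z) = F (Suc i) x y z" for i x y z
    by (simp add: F_def adj)
  have F2: "F i x (f y) z = F (Suc i) x y z" for i x y z
    by (simp add: F_def funpow_swap1)
  have F1: "F i (f x) y z = F (Suc (Suc i)) x y z" for i x y z
    by (simp add: F_def adj hom)
  have J: "F 0 x y z + F 0 y z x + F 0 z x y = 0" for x y z
    using jacobi[of x y z] by (simp add: F_def)
  \<comment> \<open>In the Jacobi identity, \<open>f\<close> is put on two arguments
    (\<open>e1\<close> to \<open>e3\<close>), twice on one (\<open>e4\<close> to \<open>e6\<close>),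
    or once on all three (\<open>e7\<close>).\<close>
  have stable: "F 3 x y z = F 2 x y z" for x y z
  proof -
    note red = F1 F2 F3 eval_nat_numeral
    have e1: "F 3 x y z + F 3 y z x + F 2 z x y = 0"
      using J[of "f x" "f y" z] by (simp add: red)
    have e2: "F 3 x y z + F 2 y z x + F 3 z x y = 0"
      using J[of "f x" y "f z"] by (simp add: red)
    have e3: "F 2 x y z + F 3 y z x + F 3 z x y = 0"
      using J[of x "f y" "f z"] by (simp add: red)
    have e4: "F 4 x y z + F 2 y z x + F 2 z x y = 0"
      using J[of "f (f x)" y z] by (simp add: red)
    have e5: "F 2 x y z + F 4 y z x + F 2 z x y = 0"
      using J[of x "f (f y)" z] by (simp add: red)
    have e6: "F 2 x y z + F 2 y z x + F 4 z x y = 0"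
      using J[of x y "f (f z)"] by (simp add: red)
    have e7: "F 4 x y z + F 4 y z x + F 4 z x y = 0"
      using J[of "f x" "f y" "f z"] by (simp add: red)
    define h where "h = F 3 x y z - F 2 x y z"
    have "h + h + h + h = 0"
      unfolding h_def by (rule quadruple_eq_0[OF e1 e2 e3 e4 e5 e6 e7])
    moreover have "(1 + 1 + 1 + 1) *s h = h + h + h + h"
      by (simp only: scale_left_distrib scale_one)
    ultimately have "4 *s h = 0"
      by simp
    then show ?thesis
      using four by (simp add: h_def)
  qed
  \<comment> \<open>Writing the middle argument as \<open>f (f w)\<close> lowers both exponents in
    \<open>stable\<close> by two.\<close>
  have "F 1 x y z = F 0 x y z" for x y z
  proof -
    obtain w where "f (f w) = y"
      using \<open>surj f\<close> by (metis surjD)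
    then show ?thesis
      using stable[of x w z] F2 by (auto simp: eval_nat_numeral)
  qed
  then have "bracket z (bracket (f x) y) = bracket z (bracket x y)" for y z
    by (simp add: F_def)
  then have "bracket z (bracket (f x - x) y) = 0" for y z
    using bracket_add_left[of "f x - x" x y] bracket_add_right[of z "bracket (f x - x) y" "bracket x y"]
    by (metis diff_add_cancel add_cancel_left_left)
  then show ?thesis
    using bracket_eq_0_commute by (simp add: second_center_def center_def)
qed

text \<open>Self-adjointness turns [f (g x), x] into [g x, f x], so the assumption is what closure
  under composition needs. Inverses follow by evaluating [f y, y] = 0 at the preimage y of
  x.\<close>

lemma subgroup_commuting_automorphisms:
  assumes "\<And>f g x. f \<in> commuting_automorphisms \<Longrightarrow> g \<in> commuting_automorphisms \<Longrightarrow>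
    bracket (f x) (g x) = 0"
  shows "subgroup commuting_automorphisms aut_group"
proof
  show "commuting_automorphisms \<subseteq> carrier aut_group"
    by (auto simp: aut_group_def commuting_automorphisms_def)
  show "\<one>\<^bsub>aut_group\<^esub> \<in> commuting_automorphisms"
    using group.is_monoid[OF group_aut_group, THEN monoid.one_closed]
    by (simp add: aut_group_def commuting_automorphisms_def bracket_self)
  fix f assume f: "f \<in> commuting_automorphisms"
  then have fG: "f \<in> carrier aut_group"
    by (simp add: aut_group_def commuting_automorphisms_def)
  let ?h = "inv\<^bsub>aut_group\<^esub> f"
  have h: "?h \<in> carrier aut_group"
    using group.inv_closed[OF group_aut_group fG] .
  have "bracket (?h x) x = 0" for x
  proof -
    have "f (?h x) = x"
      using group.r_inv[OF group_aut_group fG] by (simp add: aut_group_def fun_eq_iff)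
    moreover have "bracket (f (?h x)) (?h x) = 0"
      using f by (simp add: commuting_automorphisms_def)
    ultimately show ?thesis
      using bracket_eq_0_commute[of x "?h x"] by simp
  qed
  then show "?h \<in> commuting_automorphisms"
    using h by (simp add: aut_group_def commuting_automorphisms_def)
  fix g assume g: "g \<in> commuting_automorphisms"
  then have gG: "g \<in> carrier aut_group"
    by (simp add: aut_group_def commuting_automorphisms_def)
  have "f \<circ> g \<in> carrier aut_group"
    using group.is_monoid[OF group_aut_group, THEN monoid.m_closed, OF fG gG]
    by (simp add: aut_group_def)
  moreover have "bracket (f (g x)) x = 0" for x
    using commuting_automorphism_selfadjoint[OF f, of "g x" x] assms[OF g f] by simp
  ultimately show "f \<otimes>\<^bsub>aut_group\<^esub> g \<in> commuting_automorphisms"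
    by (simp add: aut_group_def commuting_automorphisms_def)
qed

text \<open>Both displacements lie in Z_2, hence commute with each other, and each commutes with x;
  expanding [x + u, x + v] leaves nothing.\<close>

lemma commuting_automorphisms_pair_if_second_center_abelian:
  assumes char: "CHAR('k) \<noteq> 2"
    and abelian: "\<And>u v. u \<in> second_center \<Longrightarrow> v \<in> second_center \<Longrightarrow> bracket u v = 0"
    and f: "f \<in> commuting_automorphisms" and g: "g \<in> commuting_automorphisms"
  shows "bracket (f x) (g x) = 0"
proof -
  define u v where "u = f x - x" and "v = g x - x"
  have fg: "f x = x + u" "g x = x + v"
    by (simp_all add: u_def v_def)
  have "bracket u v = 0"
    unfolding u_def v_def using commuting_automorphism_displacement char f g abelian by blast
  moreover have "bracket (x + u) x = 0" "bracket (x + v) x = 0"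
    using f g by (simp_all add: commuting_automorphisms_def flip: fg)
  then have "bracket u x = 0" "bracket x v = 0"
    by (simp_all add: bracket_add_left bracket_self bracket_eq_0_commute[of x])
  ultimately show ?thesis
    by (simp add: fg bracket_add_left bracket_add_right bracket_self)
qed

lemma commuting_automorphism_center:
  assumes "f \<in> commuting_automorphisms" "x \<in> center"
  shows "f x \<in> center"
  using commuting_automorphism_selfadjoint[OF assms(1), of x] assms(2) by (simp add: center_def)

end

section \<open>Conclusion by cases on the nilpotency class\<close>

theorem mainTheorem4:
  fixes scale :: "'k::field \<Rightarrow> 'v::ab_group_add \<Rightarrow> 'v"
    and bracket :: "'v \<Rightarrow> 'v \<Rightarrow> 'v"
    and n :: nat
  assumes "CHAR('k) \<noteq> 2"
    and "lie_algebra scale bracket"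
    and "lie_algebra.finite_dimensional scale"
    and "vector_space.dim scale (UNIV :: 'v set) = n"
    and "lie_algebra.nilpotent scale bracket UNIV"
    and "lie_algebra.coclass scale bracket UNIV = 3"
    and "n \<le> 4
      \<or> n = 5 \<and> vector_space.dim scale (lie_algebra.center bracket) \<noteq> 1
      \<or> n \<ge> 6 \<and>
          (lie_algebra.nilpotency_class scale bracket (lie_algebra.second_center bracket) \<noteq> 2
          \<or> lie_algebra.nilpotency_class scale bracket (lie_algebra.second_center bracket) = 2 \<and>
              (vector_space.dim scale (lie_algebra.center bracket) \<noteq> 1
              \<or> vector_space.dim scale (lie_algebra.second_center bracket) \<noteq> 4
              \<or> vector_space.dim scale (lie_algebra.derived scale bracket) \<noteq> n - 4))"
  shows "subgroup (lie_algebra.commuting_automorphisms scale bracket)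
           (lie_algebra.aut_group scale bracket)"
proof -
  interpret lie_algebra scale bracket
    by (rule assms(2))
  obtain B0 where B0: "finite B0" "span B0 = UNIV"
    using assms(3) by (auto simp: finite_dimensional_def)
  \<comment> \<open>The finite spanning set is thinned to a basis, the parameter that
    \<open>finite_dim_lie_algebra\<close> expects.\<close>
  obtain B where B: "B \<subseteq> B0" "independent B" "B0 \<subseteq> span B"
    by (rule maximal_independent_subset)
  have "span B = UNIV"
    using span_minimal[OF B(3) subspace_span] B0(2) by auto
  then interpret finite_dim_lie_algebra scale bracket B
    using B B0(1) finite_subset by unfold_locales auto
  define c where "c = nilpotency_class UNIV"
  have n: "dim UNIV = n" "n = c + 3"
    using assms(4,6) by (simp_all add: coclass_def c_def del: dim_UNIV)
  have zero: "lower_central UNIV c = {0}"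
    and nonzero: "\<And>i. i < c \<Longrightarrow> lower_central UNIV i \<noteq> {0}"
    using nilpotency_class_props[OF assms(5)] by (simp_all add: c_def)
  show ?thesis
  proof (rule subgroup_commuting_automorphisms)
    fix f g x
    assume f: "f \<in> commuting_automorphisms" and g: "g \<in> commuting_automorphisms"
    \<comment> \<open>Since \<open>n = c + 3\<close>, the cases are exactly dimension at most 4,
      equal to 5, and at least 6.\<close>
    consider "c \<le> 1" | "c = 2" | "c \<ge> 3"
      by linarith
    then show "bracket (f x) (g x) = 0"
    proof cases
      case 1
      then show ?thesis
        using nilpotency_class_le_1_imp_abelian[OF assms(5)] by (simp add: c_def)
    next
      case 2
      \<comment> \<open>L' is nonzero and central, so \<open>dim center\<close> is positive; the
        hypothesis for \<open>n = 5\<close> rules out 1, so it is at least 2.\<close>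
      have "lower_central UNIV 1 \<subseteq> center"
        using zero 2 by (intro lower_central_subset_center) (simp add: numeral_2_eq_2)
      then have "\<not> center \<subseteq> {0}"
        using nonzero[of 1] 2 subspace_0[OF subspace_lower_central, of 1] by auto
      then have "dim center \<noteq> 0"
        using dim_eq_0[of center] by simp
      moreover have "dim center \<noteq> 1"
        using assms(7) n 2 by auto
      ultimately have dims: "dim UNIV \<le> dim center + 3"
        using n 2 by linarith
      show ?thesis
      proof (cases "x \<in> center")
        case True
        then show ?thesis
          using commuting_automorphism_center[OF f] by (simp add: center_def)
      next
        case False
        have "bracket x (f x) = 0" "bracket x (g x) = 0"
          using f g bracket_eq_0_commute by (auto simp: commuting_automorphisms_def)
        then show ?thesis
          by (rule centralizer_abelian_if_small_center[OF dims False])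
      qed
    next
      case 3
      define m where "m = c - 3"
      have m: "c = m + 3"
        using 3 by (simp add: m_def)
      \<comment> \<open>A nonabelian Z_2 would have class 2 and exactly the three dimensions that
        the hypothesis for \<open>n \<ge> 6\<close> excludes together.\<close>
      have "bracket u v = 0" if uv: "u \<in> second_center" "v \<in> second_center" for u v
      proof (rule ccontr)
        assume nz: "bracket u v \<noteq> 0"
        have "dim center = 1 \<and> dim second_center = 4 \<and> dim derived = m + 2"
          using dims_if_second_center_nonabelian[OF _ _ _ uv nz] zero nonzero n m
          by (simp del: dim_UNIV lower_central.simps)
        moreover have "nilpotency_class second_center = 2"
          using second_center_abelian_if_class_neq_2 uv nz by blast
        ultimately show False
          using assms(7) n m by auto
      qed
      then show ?thesis
        using commuting_automorphisms_pair_if_second_center_abelian[OF assms(1) _ f g] by blast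
    qed
  qed
qed

end
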